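(* Suppose the cavity $\mathcal C$ is convex. Then there exists at least one pair $(\varrho,\mathbf g)$, with $\varrho\in L^\gamma(\mathcal C)$, $\varrho\ge0$, and $\mathbf g\in\mathbb R^2\times\{0\}$, such that $$\int_{\mathcal C}\varrho\,dx=\int_{\mathcal C}\varrho_0\,dx,\qquad |\mathbf g|=|\mathbf g_0|,$$ $$\nabla p(\varrho)=\varrho\,\mathbf g\ \text{ in }\mathcal C\ (\text{in the sense of distributions}),\qquad \mathbf e_3\cdot\left[\left(\int_{\mathcal S}\hat\varrho\,\mathbf x\,dx\right)\times\mathbf g\right]=0 .$$
   Context: $\mathcal C\subset\mathbb R^3$ (the cavity) is an open simply connected domain completely surrounded by a rigid body $\mathscr B$: $\partial\mathcal C\subset\mathscr B$, $\mathcal C\cap\mathscr B=\emptyset$, and $\mathcal S:=\mathscr B\cup\mathcal C$ is bounded, simply connected and open. The body has a prescribed density $\varrho_{\mathscr B}$ on $\mathscr B$. For a fluid density $\varrho$ on $\mathcal C$, $\hat\varrho$ is the function on $\mathcal S$ equal to $\varrho$ on $\mathcal C$ and to $\varrho_{\mathscr B}$ on $\mathscr B$. The pressure is $p(\varrho)=a\varrho^\gamma$ with $a>0$ and $\gamma>3/2$. Given data: $\varrho_0\in L^\gamma(\mathcal C)$, $\varrho_0\ge0$, $\int_{\mathcal C}\varrho_0\,dx=M>0$, and $\mathbf g_0\in\mathbb R^2\times\{0\}$, $|\mathbf g_0|=g>0$. The vector $\mathbf e_3$ is the direction of the rotation axis through the origin. *)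

theory Defs
  imports "HOL-Analysis.Analysis"
begin

(* L^p on A, as a space of functions; elements are not identified up to null sets. *)
definition Lp_on :: "real \<Rightarrow> ('a::euclidean_space) set \<Rightarrow> ('a \<Rightarrow> real) set" where
  "Lp_on p A = {f \<in> borel_measurable (lebesgue_on A).
                  integrable (lebesgue_on A) (\<lambda>x. \<bar>f x\<bar> powr p)}"

definition partial_derivative :: "('a::euclidean_space) \<Rightarrow> ('a \<Rightarrow> real) \<Rightarrow> 'a \<Rightarrow> real" where
  "partial_derivative b f x = frechet_derivative f (at x) b"

primrec Ck_function :: "nat \<Rightarrow> (('a::euclidean_space) \<Rightarrow> real) \<Rightarrow> bool" where
  "Ck_function 0 f \<longleftrightarrow> continuous_on UNIV f"
| "Ck_function (Suc k) f \<longleftrightarrow>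
     (\<forall>x. f differentiable (at x)) \<and> (\<forall>b\<in>Basis. Ck_function k (partial_derivative b f))"

definition test_function :: "('a::euclidean_space) set \<Rightarrow> ('a \<Rightarrow> real) \<Rightarrow> bool" where
  "test_function \<Omega> \<phi> \<longleftrightarrow> (\<forall>k. Ck_function k \<phi>) \<and>
     compact (closure {x. \<phi> x \<noteq> 0}) \<and> closure {x. \<phi> x \<noteq> 0} \<subseteq> \<Omega>"

definition locally_integrable_on ::
    "('a::euclidean_space \<Rightarrow> 'b::euclidean_space) \<Rightarrow> 'a set \<Rightarrow> bool" where
  "locally_integrable_on f \<Omega> \<longleftrightarrow>
     (\<forall>K. compact K \<and> K \<subseteq> \<Omega> \<longrightarrow> integrable (lebesgue_on K) f)"

(* Local integrability makes f and F regular distributions on the open set \<Omega>; without it the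
   integrals below could take the Bochner default value 0. *)
definition has_distributional_gradient_on ::
    "('a::euclidean_space \<Rightarrow> real) \<Rightarrow> ('a \<Rightarrow> 'a) \<Rightarrow> 'a set \<Rightarrow> bool" where
  "has_distributional_gradient_on f F \<Omega> \<longleftrightarrow>
     locally_integrable_on f \<Omega> \<and> locally_integrable_on F \<Omega> \<and>
     (\<forall>\<phi>. test_function \<Omega> \<phi> \<longrightarrow>
        (\<forall>b\<in>Basis.
           - (\<integral>x. f x * partial_derivative b \<phi> x \<partial>lebesgue_on \<Omega>) =
           (\<integral>x. (F x \<bullet> b) * \<phi> x \<partial>lebesgue_on \<Omega>)))"

definition pressure :: "real \<Rightarrow> real \<Rightarrow> real \<Rightarrow> real" where
  "pressure a \<gamma> r = a * r powr \<gamma>"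

(* Density of the whole system: \<rho> on the cavity C, \<rho>B on the body; only values on the union
   of body and cavity are used. *)
definition total_density :: "'a set \<Rightarrow> ('a \<Rightarrow> real) \<Rightarrow> ('a \<Rightarrow> real) \<Rightarrow> 'a \<Rightarrow> real" where
  "total_density C \<rho>B \<rho> x = (if x \<in> C then \<rho> x else \<rho>B x)"

end

theory Submission
  imports Defs
begin

text \<open>For a gravity vector \<open>v\<close> and a constant \<open>c\<close> let \<open>\<rho>(x) = d (v \<bullet> x + c)\<close>, where \<open>d\<close> is the profile
  that solves \<open>\<nabla>p(\<rho>) = \<rho> v\<close>. The pressure \<open>P s = p (d s)\<close> is a primitive of \<open>d\<close>, so with \<open>m\<close> the
  first moment of the body
  \<open>\<Phi>(v, c) = (\<integral>\<^sub>C P (v \<bullet> x + c)) - M * c + m \<bullet> v\<close>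
  has \<open>c\<close>-derivative \<open>(\<integral>\<^sub>C \<rho>) - M\<close>, and its derivative along the rotation of \<open>v\<close> about \<open>e\<^sub>3\<close> is the
  axial torque up to sign. Since \<open>P\<close> is nonnegative and superlinear, \<open>\<Phi>\<close> is coercive in \<open>c\<close>, and a
  minimiser over the circle of gravity vectors of fixed length times the real line satisfies both
  conditions.\<close>

section \<open>Parameter integrals\<close>

text \<open>By the mean value theorem every difference quotient is a value of \<open>f'\<close> near
  \<open>t0\<close>, hence dominated by \<open>w\<close>, and dominated convergence applies. The
  measure is general because both bounded domains and the whole space occur below.\<close>

lemma has_real_derivative_lebesgue_integral:
  fixes f :: "real \<Rightarrow> 'a \<Rightarrow> real"
  assumes int: "\<And>t. integrable M (f t)"
    and w: "integrable M w" and "\<delta> > 0"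
    and der: "\<And>t x. \<lbrakk>\<bar>t - t0\<bar> < \<delta>; x \<in> space M\<rbrakk> \<Longrightarrow>
                ((\<lambda>t. f t x) has_real_derivative f' t x) (at t)"
    and bound: "\<And>t x. \<lbrakk>\<bar>t - t0\<bar> < \<delta>; x \<in> space M\<rbrakk> \<Longrightarrow> \<bar>f' t x\<bar> \<le> w x"
  shows "((\<lambda>t. \<integral>x. f t x \<partial>M) has_real_derivative (\<integral>x. f' t0 x \<partial>M)) (at t0)"
proof -
  define q where "q h x = (f (t0 + h) x - f t0 x) / h" for h x
  have int_q: "integrable M (q h)" for h
    unfolding q_def using int by auto
  have q_lim: "((\<lambda>h. q h x) \<longlongrightarrow> f' t0 x) (at 0)" if "x \<in> space M" for x
    using der[of t0 x] that \<open>\<delta> > 0\<close> unfolding DERIV_def q_def by simp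
  have q_bound: "\<bar>q h x\<bar> \<le> w x" if h: "\<bar>h\<bar> < \<delta>" "h \<noteq> 0" and x: "x \<in> space M" for h x
  proof -
    \<comment> \<open>Ordering the endpoints lets one use of the mean value theorem cover both signs
      of \<open>h\<close>.\<close>
    define lo hi where "lo = min t0 (t0 + h)" and "hi = max t0 (t0 + h)"
    have "lo < hi"
      using h by (auto simp: lo_def hi_def)
    moreover have "((\<lambda>t. f t x) has_real_derivative f' t x) (at t)" if "lo \<le> t" "t \<le> hi" for t
    proof (rule der[OF _ x])
      show "\<bar>t - t0\<bar> < \<delta>"
        using that h(1) unfolding lo_def hi_def by linarith
    qed
    ultimately obtain z where z: "lo < z" "z < hi" "f hi x - f lo x = (hi - lo) * f' z x"
      using MVT2[of lo hi "\<lambda>t. f t x" "\<lambda>t. f' t x"] by blast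
    have "q h x = f' z x"
      using z(3) h by (cases "h > 0") (auto simp: q_def lo_def hi_def field_simps)
    moreover have "\<bar>z - t0\<bar> < \<delta>"
      using z(1,2) h(1) unfolding lo_def hi_def by linarith
    ultimately show ?thesis
      using bound x by simp
  qed
  \<comment> \<open>Restricting to the interval keeps every term of a test sequence in the range
    where \<open>q_bound\<close> holds; the interval is open, so the limit is the same.\<close>
  have "((\<lambda>h. \<integral>x. q h x \<partial>M) \<longlongrightarrow> (\<integral>x. f' t0 x \<partial>M)) (at 0 within {-\<delta><..<\<delta>})"
    unfolding tendsto_at_iff_sequentially
  proof (intro allI impI)
    fix X :: "nat \<Rightarrow> real"
    assume X: "\<forall>i. X i \<in> {-\<delta><..<\<delta>} - {0}" "X \<longlonglongrightarrow> 0"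
    have X0: "filterlim X (at 0) sequentially"
      using X by (auto simp: filterlim_at)
    have lim: "(\<lambda>i. q (X i) x) \<longlonglongrightarrow> f' t0 x" if "x \<in> space M" for x
      using filterlim_compose[OF q_lim[OF that] X0] .
    have "(\<lambda>i. \<integral>x. q (X i) x \<partial>M) \<longlonglongrightarrow> (\<integral>x. f' t0 x \<partial>M)"
    proof (rule integral_dominated_convergence[where w = w])
      \<comment> \<open>Measurability of \<open>f' t0\<close> comes from its being a pointwise limit
        of difference quotients.\<close>
      show "f' t0 \<in> borel_measurable M"
        by (rule borel_measurable_LIMSEQ_real[where u = "\<lambda>i. q (X i)"])
           (use lim int_q in auto)
      show "AE x in M. norm (q (X i) x) \<le> w x" for i
        using q_bound[of "X i"] X(1)[rule_format, of i] by (auto simp: abs_less_iff)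
    qed (use w lim int_q in auto)
    then show "((\<lambda>h. \<integral>x. q h x \<partial>M) \<circ> X) \<longlonglongrightarrow> (\<integral>x. f' t0 x \<partial>M)"
      by (simp add: o_def)
  qed
  then have "((\<lambda>h. \<integral>x. q h x \<partial>M) \<longlongrightarrow> (\<integral>x. f' t0 x \<partial>M)) (at 0)"
    using \<open>\<delta> > 0\<close> at_within_open[of 0 "{-\<delta><..<\<delta>}"] by simp
  moreover have "(\<integral>x. q h x \<partial>M) = ((\<integral>x. f (t0 + h) x \<partial>M) - (\<integral>x. f t0 x \<partial>M)) / h" for h
    unfolding q_def using int by simp
  ultimately show ?thesis
    unfolding DERIV_def by simp
qed

lemma finite_measure_lebesgue_on_bounded:
  assumes "bounded A" "A \<in> sets lebesgue"
  shows "finite_measure (lebesgue_on A)"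
proof
  have "emeasure lebesgue A < \<infinity>"
    using assms bounded_set_imp_lmeasurable fmeasurableD2
    by (metis infinity_ennreal_def top.not_eq_extremum)
  then show "emeasure (lebesgue_on A) (space (lebesgue_on A)) \<noteq> \<infinity>"
    using assms by (simp add: emeasure_restrict_space)
qed

lemma integrable_lebesgue_on_bounded_continuous:
  fixes f :: "'a::euclidean_space \<Rightarrow> 'b::euclidean_space"
  assumes "bounded A" "A \<in> sets lebesgue" "continuous_on UNIV f"
  shows "integrable (lebesgue_on A) f"
proof -
  obtain K where K: "compact K" "A \<subseteq> K"
    using assms(1) by (meson closure_subset compact_closure)
  have "compact (f ` K)"
    using K(1) assms(3) by (meson compact_continuous_image continuous_on_subset subset_UNIV)
  then obtain B where B: "\<And>x. x \<in> K \<Longrightarrow> norm (f x) \<le> B"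
    using compact_imp_bounded bounded_iff by (metis imageI)
  show ?thesis
  proof (rule finite_measure.integrable_const_bound[OF finite_measure_lebesgue_on_bounded[OF assms(1,2)]])
    show "f \<in> borel_measurable (lebesgue_on A)"
      using assms by (intro continuous_imp_measurable_on_sets_lebesgue)
        (auto intro: continuous_on_subset)
    show "AE x in lebesgue_on A. norm (f x) \<le> B"
      using B K(2) by (intro AE_I2) auto
  qed
qed

text \<open>The bound is the one on the compact set \<open>K \<times> closure A\<close>; it supplies
  constant dominating functions on bounded domains.\<close>

lemma compact_Times_closure_bound:
  fixes f :: "'b::metric_space \<times> 'a::euclidean_space \<Rightarrow> real"
  assumes "compact K" "bounded A" "continuous_on (K \<times> UNIV) f"
  obtains B where "\<And>t x. \<lbrakk>t \<in> K; x \<in> A\<rbrakk> \<Longrightarrow> \<bar>f (t, x)\<bar> \<le> B"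
proof -
  have "compact (K \<times> closure A)"
    using assms by (simp add: compact_Times compact_closure)
  moreover have "continuous_on (K \<times> closure A) f"
    using assms(3) by (rule continuous_on_subset) auto
  ultimately have "bounded (f ` (K \<times> closure A))"
    using compact_continuous_image compact_imp_bounded by blast
  then obtain B where B: "\<forall>y\<in>f ` (K \<times> closure A). \<bar>y\<bar> \<le> B"
    unfolding bounded_iff real_norm_def by blast
  show thesis
  proof (rule that)
    show "\<bar>f (t, x)\<bar> \<le> B" if "t \<in> K" "x \<in> A" for t x
    proof -
      have "f (t, x) \<in> f ` (K \<times> closure A)"
        using that closure_subset[THEN subsetD] by (intro imageI SigmaI)
      then show ?thesis
        using B by blast
    qed
  qed
qed

text \<open>On \<open>cball t0 1\<close> times the bounded set \<open>A\<close> the continuous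
  \<open>f'\<close> is bounded, and a constant is integrable over a set of finite measure.\<close>

lemma has_real_derivative_integral_bounded_set:
  fixes f :: "real \<Rightarrow> 'a::euclidean_space \<Rightarrow> real"
  assumes A: "bounded A" "A \<in> sets lebesgue"
    and der: "\<And>t x. ((\<lambda>t. f t x) has_real_derivative f' t x) (at t)"
    and f: "\<And>t. continuous_on UNIV (f t)"
    and f': "continuous_on UNIV (\<lambda>(t, x). f' t x)"
  shows "((\<lambda>t. \<integral>x. f t x \<partial>lebesgue_on A) has_real_derivative
           (\<integral>x. f' t0 x \<partial>lebesgue_on A)) (at t0)"
proof -
  obtain B where B: "\<And>t x. \<lbrakk>t \<in> cball t0 1; x \<in> A\<rbrakk> \<Longrightarrow> \<bar>(\<lambda>(t, x). f' t x) (t, x)\<bar> \<le> B"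
    using compact_Times_closure_bound[OF compact_cball A(1) continuous_on_subset[OF f' subset_UNIV]]
    by metis
  show ?thesis
  proof (rule has_real_derivative_lebesgue_integral[where \<delta> = 1 and w = "\<lambda>_. B"])
    show "integrable (lebesgue_on A) (\<lambda>_. B)"
      using finite_measure.integrable_const finite_measure_lebesgue_on_bounded[OF A] by blast
    show "integrable (lebesgue_on A) (f t)" for t
      using A f by (rule integrable_lebesgue_on_bounded_continuous)
    show "\<bar>f' t x\<bar> \<le> B" if "\<bar>t - t0\<bar> < 1" "x \<in> space (lebesgue_on A)" for t x
      using B[of t x] that by (simp add: dist_real_def abs_minus_commute)
  qed (use der in auto)
qed

text \<open>Dominated convergence along sequences in \<open>K\<close>, with a constant bound from
  compactness. It gives the continuity needed for a minimiser to exist.\<close>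

lemma continuous_on_integral_bounded_set:
  fixes f :: "'b::metric_space \<Rightarrow> 'a::euclidean_space \<Rightarrow> real"
  assumes A: "bounded A" "A \<in> sets lebesgue"
    and K: "compact K" and f: "continuous_on UNIV (\<lambda>(t, x). f t x)"
  shows "continuous_on K (\<lambda>t. \<integral>x. f t x \<partial>lebesgue_on A)"
  unfolding continuous_on_sequentially
proof (intro allI ballI impI)
  fix X t assume "t \<in> K" and X: "(\<forall>n. X n \<in> K) \<and> X \<longlonglongrightarrow> t"
  obtain B where B: "\<And>t x. \<lbrakk>t \<in> K; x \<in> A\<rbrakk> \<Longrightarrow> \<bar>(\<lambda>(t, x). f t x) (t, x)\<bar> \<le> B"
    using compact_Times_closure_bound[OF K A(1) continuous_on_subset[OF f subset_UNIV]] by metis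
  have meas: "f t \<in> borel_measurable (lebesgue_on A)" for t
  proof (rule continuous_imp_measurable_on_sets_lebesgue[OF _ A(2)])
    show "continuous_on A (f t)"
      using continuous_on_compose2[OF f, of A "\<lambda>x. (t, x)"] by (simp add: continuous_on_Pair)
  qed
  have "(\<lambda>n. \<integral>x. f (X n) x \<partial>lebesgue_on A) \<longlonglongrightarrow> (\<integral>x. f t x \<partial>lebesgue_on A)"
  proof (rule integral_dominated_convergence[where w = "\<lambda>_. B"])
    show "integrable (lebesgue_on A) (\<lambda>_. B)"
      using finite_measure.integrable_const finite_measure_lebesgue_on_bounded[OF A] by blast
    have "(\<lambda>n. f (X n) x) \<longlonglongrightarrow> f t x" for x
    proof -
      have "(\<lambda>n. (X n, x)) \<longlonglongrightarrow> (t, x)"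
        using X by (auto intro: tendsto_intros)
      moreover have "isCont (\<lambda>(t, x). f t x) (t, x)"
        using f by (simp add: continuous_on_eq_continuous_at)
      ultimately show ?thesis
        using isCont_tendsto_compose by fastforce
    qed
    then show "AE x in lebesgue_on A. (\<lambda>n. f (X n) x) \<longlonglongrightarrow> f t x"
      by simp
    show "AE x in lebesgue_on A. norm (f (X n) x) \<le> B" for n
      using B[of "X n"] X by (intro AE_I2) simp
  qed (use meas in auto)
  then show "((\<lambda>t. \<integral>x. f t x \<partial>lebesgue_on A) \<circ> X) \<longlonglongrightarrow> (\<integral>x. f t x \<partial>lebesgue_on A)"
    by (simp add: o_def)
qed

section \<open>Critical points of the potential\<close>

text \<open>Both equations are first-order conditions at a minimum of \<open>\<Phi>\<close>:
  variation of the level \<open>c\<close> gives the mass, variation of \<open>v\<close> the torque.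
  The premise on \<open>J\<close> provides a curve in \<open>S\<close> through \<open>v\<close> with
  velocity \<open>J v\<close>.\<close>

lemma exists_critical_direction_and_level:
  fixes C S :: "'a::euclidean_space set" and P d :: "real \<Rightarrow> real" and J :: "'a \<Rightarrow> 'a"
  assumes C: "open C" "bounded C" "C \<noteq> {}"
    and P: "\<And>s. (P has_real_derivative d s) (at s)" "\<And>s. P s \<ge> 0"
    and d: "continuous_on UNIV d"
    and growth: "\<And>k. \<exists>s1. \<forall>s\<ge>s1. k * s \<le> P s"
    and S: "compact S" "S \<noteq> {}"
    and J: "\<And>v t. v \<in> S \<Longrightarrow> cos t *\<^sub>R v + sin t *\<^sub>R J v \<in> S"
    and M: "M > 0"
  shows "\<exists>v\<in>S. \<exists>c. (\<integral>x. d (v \<bullet> x + c) \<partial>lebesgue_on C) = M \<and>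
           (m + (\<integral>x. d (v \<bullet> x + c) *\<^sub>R x \<partial>lebesgue_on C)) \<bullet> J v = 0"
proof -
  have C_sets: "C \<in> sets lebesgue"
    using C(1) by simp
  note integrable = integrable_lebesgue_on_bounded_continuous[OF C(2) C_sets]
  define V where "V = measure lebesgue C"
  have "V > 0"
    using C open_not_negligible[of C] bounded_set_imp_lmeasurable[OF C(2) C_sets]
    by (simp add: V_def negligible_iff_measure zero_less_measure_iff)
  have P_cont: "continuous_on UNIV P"
    using P(1) by (meson DERIV_isCont continuous_at_imp_continuous_on)
  have cont_P [continuous_intros]: "continuous_on X (\<lambda>x. P (h x))" if "continuous_on X h"
    for X :: "'b::topological_space set" and h
    using continuous_on_compose2[OF P_cont that] by simp
  have cont_d [continuous_intros]: "continuous_on X (\<lambda>x. d (h x))" if "continuous_on X h"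
    for X :: "'b::topological_space set" and h
    using continuous_on_compose2[OF d that] by simp
  define \<Phi> where
    "\<Phi> v c = (\<integral>x. P (v \<bullet> x + c) \<partial>lebesgue_on C) - M * c + m \<bullet> v" for v c
  obtain g where g: "\<And>v. v \<in> S \<Longrightarrow> norm v \<le> g" "g \<ge> 0"
    using compact_imp_bounded[OF S(1)] by (metis bounded_pos less_eq_real_def)
  obtain D where D: "\<And>x. x \<in> C \<Longrightarrow> norm x \<le> D" "D \<ge> 0"
    using C(2) by (metis bounded_pos less_eq_real_def)
  \<comment> \<open>Dropping the nonnegative pressure integral leaves \<open>- M * c\<close>, which
    controls \<open>c\<close> towards minus infinity.\<close>
  have low1: "\<Phi> v c \<ge> - M * c - norm m * g" if "v \<in> S" for v c
  proof -
    have "\<bar>m \<bullet> v\<bar> \<le> norm m * g"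
      using Cauchy_Schwarz_ineq2[of m v] g(1)[OF that] mult_left_mono[of "norm v" g "norm m"] by simp
    moreover have "(\<integral>x. P (v \<bullet> x + c) \<partial>lebesgue_on C) \<ge> 0"
      using P(2) by simp
    ultimately show ?thesis
      unfolding \<Phi>_def by linarith
  qed
  \<comment> \<open>The slope \<open>2 * M / V\<close> integrates over \<open>C\<close> to
    \<open>2 * M\<close>, so that after subtracting \<open>M * c\<close> a growth of
    \<open>M * c\<close> remains.\<close>
  obtain s1 where s1: "\<And>s. s \<ge> s1 \<Longrightarrow> 2 * M / V * s \<le> P s"
    using growth by blast
  have low2: "\<Phi> v c \<ge> M * c - 2 * M * (g * D) - norm m * g" if "v \<in> S" "c \<ge> s1 + g * D" for v c
  proof -
    have "2 * M / V * (c - g * D) \<le> P (v \<bullet> x + c)" if "x \<in> C" for x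
    proof -
      \<comment> \<open>Since \<open>v \<bullet> x\<close> varies by at most \<open>g * D\<close>, a
        level above \<open>s1 + g * D\<close> puts the whole cavity in the range of
        \<open>s1\<close>.\<close>
      have "\<bar>v \<bullet> x\<bar> \<le> g * D"
        using Cauchy_Schwarz_ineq2[of v x] mult_mono[OF g(1)[OF \<open>v \<in> S\<close>] D(1)[OF that]] g(2)
        by simp
      then have "v \<bullet> x + c \<ge> s1" "c - g * D \<le> v \<bullet> x + c"
        using \<open>c \<ge> s1 + g * D\<close> by linarith+
      then show ?thesis
        using s1[of "v \<bullet> x + c"] mult_left_mono[of "c - g * D" "v \<bullet> x + c" "2 * M / V"] M \<open>V > 0\<close>
        by simp
    qed
    then have "(\<integral>x. 2 * M / V * (c - g * D) \<partial>lebesgue_on C)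
        \<le> (\<integral>x. P (v \<bullet> x + c) \<partial>lebesgue_on C)"
      using C_sets by (intro integral_mono integrable continuous_intros) auto
    moreover have "(\<integral>x. 2 * M / V * (c - g * D) \<partial>lebesgue_on C) = 2 * M * (c - g * D)"
      using C_sets \<open>V > 0\<close> by (simp add: measure_restrict_space V_def field_simps)
    moreover have "\<bar>m \<bullet> v\<bar> \<le> norm m * g"
      using Cauchy_Schwarz_ineq2[of m v] g(1)[OF \<open>v \<in> S\<close>] mult_left_mono[of "norm v" g "norm m"]
      by simp
    ultimately show ?thesis
      unfolding \<Phi>_def by (simp add: algebra_simps)
  qed
  obtain v1 where v1: "v1 \<in> S"
    using S(2) by blast
  \<comment> \<open>Beyond \<open>R\<close> in absolute value, \<open>low1\<close> or
    \<open>low2\<close> exceeds the reference value \<open>\<Phi> v1 0\<close>; the entry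
    \<open>0\<close> places the reference point inside the compact strip.\<close>
  define R where "R = Max {0, s1 + g * D, (\<Phi> v1 0 + 2 * M * (g * D) + norm m * g) / M}"
  have R: "R \<ge> 0" "R \<ge> s1 + g * D" "M * R \<ge> \<Phi> v1 0 + 2 * M * (g * D) + norm m * g"
  proof -
    show "R \<ge> 0"
      unfolding R_def by (rule Max_ge) simp_all
    show "R \<ge> s1 + g * D"
      unfolding R_def by (rule Max_ge) simp_all
    have "(\<Phi> v1 0 + 2 * M * (g * D) + norm m * g) / M \<le> R"
      unfolding R_def by (rule Max_ge) simp_all
    then show "M * R \<ge> \<Phi> v1 0 + 2 * M * (g * D) + norm m * g"
      using M by (simp only: pos_divide_le_eq mult.commute)
  qed
  have outside: "\<Phi> v1 0 \<le> \<Phi> v c" if "v \<in> S" "c \<notin> {-R..R}" for v c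
  proof -
    have *: "0 \<le> 2 * M * (g * D)"
      using M g(2) D(2) by simp
    have "c > R \<or> - c > R"
      using that(2) by auto
    then have "(M * c > M * R \<and> c \<ge> s1 + g * D) \<or> - M * c > M * R"
      using M R(2) mult_strict_left_mono[of R c M] mult_strict_left_mono[of R "- c" M] by auto
    then show ?thesis
    proof
      assume "M * c > M * R \<and> c \<ge> s1 + g * D"
      then show ?thesis
        using low2[OF that(1), of c] R(3) by linarith
    next
      assume "- M * c > M * R"
      then show ?thesis
        using low1[OF that(1), of c] R(3) * by linarith
    qed
  qed
  have "continuous_on (S \<times> {-R..R}) (\<lambda>w. \<integral>x. P (fst w \<bullet> x + snd w) \<partial>lebesgue_on C)"
  proof (rule continuous_on_integral_bounded_set[OF C(2) C_sets])
    show "compact (S \<times> {-R..R})"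
      using S(1) by (intro compact_Times) auto
    show "continuous_on UNIV (\<lambda>(w, x). P (fst w \<bullet> x + snd w))"
      unfolding case_prod_beta by (intro continuous_intros)
  qed
  then have \<Phi>_cont: "continuous_on (S \<times> {-R..R}) (\<lambda>w. \<Phi> (fst w) (snd w))"
    unfolding \<Phi>_def by (intro continuous_intros)
  have "compact (S \<times> {-R..R})" "S \<times> {-R..R} \<noteq> {}"
    using S R(1) by (auto intro: compact_Times)
  then obtain w0 where w0: "w0 \<in> S \<times> {-R..R}"
      and w0_min: "\<And>w. w \<in> S \<times> {-R..R} \<Longrightarrow> \<Phi> (fst w0) (snd w0) \<le> \<Phi> (fst w) (snd w)"
    using continuous_attains_inf[OF _ _ \<Phi>_cont] by blast
  define v0 c0 where "v0 = fst w0" and "c0 = snd w0"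
  have v0: "v0 \<in> S"
    using w0 by (auto simp: v0_def)
  have inside: "\<Phi> v0 c0 \<le> \<Phi> v c" if "v \<in> S" "c \<in> {-R..R}" for v c
    using w0_min[of "(v, c)"] that by (simp add: v0_def c0_def)
  \<comment> \<open>The minimum over the compact strip is global, because outside the strip
    \<open>\<Phi>\<close> is at least its value at the interior reference point.\<close>
  have min: "\<Phi> v0 c0 \<le> \<Phi> v c" if "v \<in> S" for v c
  proof (cases "c \<in> {-R..R}")
    case False
    have "\<Phi> v0 c0 \<le> \<Phi> v1 0"
      using v1 R(1) by (intro inside) auto
    also have "\<dots> \<le> \<Phi> v c"
      using outside[OF that False] .
    finally show ?thesis .
  qed (use inside that in blast)
  let ?\<rho> = "\<lambda>x. d (v0 \<bullet> x + c0)"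
  \<comment> \<open>This is the vanishing derivative at \<open>t = 0\<close> along the curve that
    turns \<open>v0\<close> towards \<open>J v0\<close> while the level moves as
    \<open>c0 + k * t\<close>.\<close>
  have critical: "(m + (\<integral>x. ?\<rho> x *\<^sub>R x \<partial>lebesgue_on C)) \<bullet> J v0
      + k * ((\<integral>x. ?\<rho> x \<partial>lebesgue_on C) - M) = 0" for k
  proof -
    let ?v = "\<lambda>t. cos t *\<^sub>R v0 + sin t *\<^sub>R J v0"
    let ?v' = "\<lambda>t. - sin t *\<^sub>R v0 + cos t *\<^sub>R J v0"
    have "((\<lambda>t. \<integral>x. P (?v t \<bullet> x + (c0 + k * t)) \<partial>lebesgue_on C) has_real_derivative
        (\<integral>x. d (?v 0 \<bullet> x + (c0 + k * 0)) * (?v' 0 \<bullet> x + k) \<partial>lebesgue_on C)) (at 0)"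
    proof (rule has_real_derivative_integral_bounded_set[OF C(2) C_sets,
          where f' = "\<lambda>t x. d (?v t \<bullet> x + (c0 + k * t)) * (?v' t \<bullet> x + k)"])
      show "((\<lambda>t. P (?v t \<bullet> x + (c0 + k * t))) has_real_derivative
          d (?v t \<bullet> x + (c0 + k * t)) * (?v' t \<bullet> x + k)) (at t)" for t x
      proof (rule DERIV_chain2[OF P(1)])
        show "((\<lambda>t. ?v t \<bullet> x + (c0 + k * t)) has_real_derivative ?v' t \<bullet> x + k) (at t)"
          unfolding inner_add_left inner_scaleR_left
          by (auto intro!: derivative_eq_intros)
      qed
    qed (auto simp: case_prod_beta intro!: continuous_intros)
    then have "((\<lambda>t. \<Phi> (?v t) (c0 + k * t)) has_real_derivative
        (\<integral>x. ?\<rho> x * (J v0 \<bullet> x + k) \<partial>lebesgue_on C) - M * k + m \<bullet> J v0) (at 0)"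
      unfolding \<Phi>_def inner_add_right inner_scaleR_right
      by (auto intro!: derivative_eq_intros)
    moreover have "\<forall>t. \<Phi> (?v 0) (c0 + k * 0) \<le> \<Phi> (?v t) (c0 + k * t)"
      using min J[OF v0] by simp
    ultimately have "(\<integral>x. ?\<rho> x * (J v0 \<bullet> x + k) \<partial>lebesgue_on C) - M * k + m \<bullet> J v0 = 0"
      by (intro DERIV_local_min[OF _ zero_less_one]) auto
    moreover have "(\<integral>x. ?\<rho> x * (J v0 \<bullet> x + k) \<partial>lebesgue_on C) =
        (\<integral>x. (?\<rho> x *\<^sub>R x) \<bullet> J v0 + k * ?\<rho> x \<partial>lebesgue_on C)"
      by (simp add: algebra_simps inner_commute)
    moreover have "\<dots> = (\<integral>x. (?\<rho> x *\<^sub>R x) \<bullet> J v0 \<partial>lebesgue_on C)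
        + (\<integral>x. k * ?\<rho> x \<partial>lebesgue_on C)"
      by (intro Bochner_Integration.integral_add integrable continuous_intros)
    moreover have "(\<integral>x. (?\<rho> x *\<^sub>R x) \<bullet> J v0 \<partial>lebesgue_on C) =
        (\<integral>x. ?\<rho> x *\<^sub>R x \<partial>lebesgue_on C) \<bullet> J v0"
      by (intro integral_inner_left integrable continuous_intros)
    ultimately show ?thesis
      by (simp add: inner_add_left algebra_simps)
  qed
  \<comment> \<open>The choice \<open>k = 0\<close> isolates the torque; with it,
    \<open>k = 1\<close> gives the mass.\<close>
  show ?thesis
    using critical[of 0] critical[of 1] v0 by auto
qed

section \<open>Distributional gradients of continuously differentiable functions\<close>

lemma lborel_integral_translation:
  fixes f :: "'a::euclidean_space \<Rightarrow> 'b::{banach, second_countable_topology}"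
  assumes "f \<in> borel_measurable borel"
  shows "(\<integral>x. f (c + x) \<partial>lborel) = (\<integral>x. f x \<partial>lborel)"
  using integral_distr[of "(+) c" lborel borel f] assms by (simp add: lborel_distr_plus)

text \<open>The complement of \<open>K\<close> is open, so \<open>h\<close> vanishes on a whole
  neighbourhood of \<open>x\<close>.\<close>

lemma has_derivative_eq_0_outside:
  assumes der: "\<And>x. (h has_derivative h' x) (at x)"
    and "closed K" "\<And>x. x \<notin> K \<Longrightarrow> h x = 0" "x \<notin> K"
  shows "h' x = (\<lambda>_. 0)"
proof -
  have "((\<lambda>_. 0) has_derivative h' x) (at x)"
    by (rule has_derivative_transform_within_open[OF der, of "- K"]) (use assms in auto)
  then show ?thesis
    using has_derivative_unique[OF _ has_derivative_const] by metis
qed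

text \<open>By translation invariance the integral of \<open>h (t *\<^sub>R b + x)\<close> does not
  depend on \<open>t\<close>; differentiating under the integral at \<open>t = 0\<close> gives the
  claim.\<close>

lemma integral_directional_derivative_compact_support:
  fixes h :: "'a::euclidean_space \<Rightarrow> real"
  assumes der: "\<And>x. (h has_derivative h' x) (at x)"
    and cont: "continuous_on UNIV (\<lambda>x. h' x b)"
    and K: "compact K" "\<And>x. x \<notin> K \<Longrightarrow> h x = 0"
  shows "(\<integral>x. h' x b \<partial>lebesgue) = 0"
proof -
  have h_cont: "continuous_on UNIV h"
    using der by (meson continuous_at_imp_continuous_on has_derivative_continuous)
  have h'_0: "h' x b = 0" if "x \<notin> K" for x
    using has_derivative_eq_0_outside[OF der compact_imp_closed[OF K(1)] K(2) that] by simp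
  obtain R where R: "\<And>x. x \<in> K \<Longrightarrow> norm x \<le> R"
    using K(1) compact_imp_bounded bounded_iff by metis
  have "compact ((\<lambda>x. h' x b) ` K)"
    using K(1) cont by (meson compact_continuous_image continuous_on_subset subset_UNIV)
  then obtain B where B: "\<And>x. x \<in> K \<Longrightarrow> \<bar>h' x b\<bar> \<le> B"
    using compact_imp_bounded bounded_iff by (metis imageI real_norm_def)
  \<comment> \<open>For \<open>\<bar>t\<bar> < 1\<close> the translated support lies in the ball of
    radius \<open>R + norm b\<close>. The maximum with \<open>0\<close> keeps \<open>w\<close>
    nonnegative even if \<open>K\<close> is empty and \<open>B\<close> negative.\<close>
  define w where "w x = max 0 B * indicator (cball 0 (R + norm b)) x" for x :: 'a
  have [measurable]: "h \<in> borel_measurable borel" "(\<lambda>x. h' x b) \<in> borel_measurable borel"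
    using h_cont cont by (auto intro: borel_measurable_continuous_onI)
  have int_h: "integrable lborel h"
    using borel_integrable_compact[OF K(1) continuous_on_subset[OF h_cont subset_UNIV]]
    by (rule Bochner_Integration.integrable_cong[THEN iffD1, rotated -1])
       (use K in \<open>auto simp: indicator_def\<close>)
  have "((\<lambda>t. \<integral>x. h (t *\<^sub>R b + x) \<partial>lborel) has_real_derivative
          (\<integral>x. h' (0 *\<^sub>R b + x) b \<partial>lborel)) (at 0)"
  proof (rule has_real_derivative_lebesgue_integral[where \<delta> = 1 and w = w])
    show "integrable lborel (\<lambda>x. h (t *\<^sub>R b + x))" for t
      using int_h integrable_distr[of "(+) (t *\<^sub>R b)" lborel borel h]
      by (simp add: lborel_distr_plus)
    show "integrable lborel w"
      unfolding w_def
      by (auto intro!: integrable_real_mult_indicator emeasure_bounded_finite)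
    show "((\<lambda>t. h (t *\<^sub>R b + x)) has_real_derivative h' (t *\<^sub>R b + x) b) (at t)" for t x
    proof -
      have "((\<lambda>t. t *\<^sub>R b + x) has_derivative (\<lambda>s. s *\<^sub>R b)) (at t)"
        by (auto intro!: derivative_eq_intros)
      from has_derivative_compose[OF this der]
      have "((\<lambda>t. h (t *\<^sub>R b + x)) has_derivative (\<lambda>s. h' (t *\<^sub>R b + x) (s *\<^sub>R b))) (at t)" .
      moreover have "h' y (s *\<^sub>R b) = h' y b * s" for y s
        using linear_cmul[OF has_derivative_linear[OF der]] by simp
      ultimately show ?thesis
        by (simp add: has_field_derivative_def)
    qed
    show "\<bar>h' (t *\<^sub>R b + x) b\<bar> \<le> w x" if "\<bar>t - 0\<bar> < 1" for t x
    proof (cases "t *\<^sub>R b + x \<in> K")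
      case True
      have "norm x \<le> norm (t *\<^sub>R b + x) + norm (t *\<^sub>R b)"
        by (metis add.commute add_diff_cancel_left' norm_triangle_ineq4)
      also have "norm (t *\<^sub>R b) \<le> norm b"
        using that by (simp add: mult_left_le_one_le)
      finally have "norm x \<le> R + norm b"
        using R[OF True] by simp
      then show ?thesis
        using B[OF True] by (simp add: w_def)
    qed (simp add: h'_0 w_def)
  qed simp
  moreover have "(\<integral>x. h (t *\<^sub>R b + x) \<partial>lborel) = (\<integral>x. h x \<partial>lborel)" for t
    by (rule lborel_integral_translation) simp
  ultimately have "((\<lambda>t::real. \<integral>x. h x \<partial>lborel) has_real_derivative (\<integral>x. h' x b \<partial>lborel)) (at 0)"
    by simp
  then have "(\<integral>x. h' x b \<partial>lborel) = 0"
    using DERIV_unique DERIV_const by blast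
  then show ?thesis
    by (simp add: integral_completion)
qed

text \<open>Integration by parts: \<open>f\<close> times a test function is continuously
  differentiable with compact support, so its partial derivatives integrate to zero; the product
  rule splits this integral.\<close>

lemma C1_imp_distributional_gradient:
  fixes f :: "'a::euclidean_space \<Rightarrow> real"
  assumes der: "\<And>x. (f has_derivative (\<lambda>y. F x \<bullet> y)) (at x)"
    and F: "continuous_on UNIV F" and \<Omega>: "\<Omega> \<in> sets lebesgue"
  shows "has_distributional_gradient_on f F \<Omega>"
  unfolding has_distributional_gradient_on_def locally_integrable_on_def
proof (intro conjI allI impI ballI)
  have f: "continuous_on UNIV f"
    using der by (meson continuous_at_imp_continuous_on has_derivative_continuous)
  show "integrable (lebesgue_on K) f" "integrable (lebesgue_on K) F" if "compact K \<and> K \<subseteq> \<Omega>" for K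
    using that f F
    by (auto intro!: integrable_lebesgue_on_bounded_continuous compact_imp_bounded
        simp: lmeasurable_compact fmeasurableD)
  fix \<phi> :: "'a \<Rightarrow> real" and b :: 'a
  assume "test_function \<Omega> \<phi>" and b: "b \<in> Basis"
  define K where "K = closure {x. \<phi> x \<noteq> 0}"
  have Ck: "\<And>k. Ck_function k \<phi>" and K: "compact K" "K \<subseteq> \<Omega>"
    using \<open>test_function \<Omega> \<phi>\<close> by (auto simp: test_function_def K_def)
  have \<phi>_0: "\<phi> x = 0" if "x \<notin> K" for x
    using that closure_subset[of "{x. \<phi> x \<noteq> 0}"] by (auto simp: K_def)
  let ?D = "\<lambda>x. frechet_derivative \<phi> (at x)"
  have \<phi>_der: "(\<phi> has_derivative ?D x) (at x)" for x
    using Ck[of 1] by (auto simp: frechet_derivative_works)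
  have \<phi>: "continuous_on UNIV \<phi>" and D: "continuous_on UNIV (\<lambda>x. ?D x b)"
    using Ck[of 0] Ck[of "Suc 0"] b by (auto simp: partial_derivative_def[abs_def])
  have D_0: "?D x b = 0" if "x \<notin> K" for x
    using has_derivative_eq_0_outside[OF \<phi>_der compact_imp_closed[OF K(1)] \<phi>_0 that] by simp
  \<comment> \<open>Passing from \<open>\<Omega>\<close> to the compact support makes each
    continuous integrand integrable, as the splitting below requires.\<close>
  have on_\<Omega>: "(\<integral>x. k x \<partial>lebesgue_on \<Omega>) = (\<integral>x. k x \<partial>lebesgue_on K)"
    if "\<And>x. x \<notin> K \<Longrightarrow> k x = 0" for k :: "'a \<Rightarrow> real"
  proof -
    have "(\<integral>x. k x \<partial>lebesgue_on \<Omega>) = (\<integral>x. (if x \<in> K then k x else 0) \<partial>lebesgue_on \<Omega>)"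
      using that by (intro Bochner_Integration.integral_cong) auto
    also have "\<dots> = (\<integral>x. k x \<partial>lebesgue_on K)"
      using Lebesgue_Measure.integral_restrict_Int[of K \<Omega> k] K \<Omega>
      by (simp add: lmeasurable_compact fmeasurableD Int_absorb2)
    finally show ?thesis .
  qed
  let ?h' = "\<lambda>x y. f x * ?D x y + (F x \<bullet> y) * \<phi> x"
  have "(\<integral>x. ?h' x b \<partial>lebesgue) = 0"
  proof (rule integral_directional_derivative_compact_support[where h = "\<lambda>x. f x * \<phi> x", OF _ _ K(1)])
    show "((\<lambda>x. f x * \<phi> x) has_derivative ?h' x) (at x)" for x
      using has_derivative_mult[OF der \<phi>_der] .
    show "continuous_on UNIV (\<lambda>x. ?h' x b)"
      using f F \<phi> D by (intro continuous_intros)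
  qed (simp add: \<phi>_0)
  moreover have "(\<integral>x. ?h' x b \<partial>lebesgue) = (\<integral>x. ?h' x b \<partial>lebesgue_on K)"
    using K(1)
    by (subst Lebesgue_Measure.integral_restrict_UNIV[symmetric])
       (auto simp: lmeasurable_compact fmeasurableD \<phi>_0 D_0 intro!: Bochner_Integration.integral_cong)
  moreover have "(\<integral>x. ?h' x b \<partial>lebesgue_on K) =
      (\<integral>x. f x * ?D x b \<partial>lebesgue_on K) + (\<integral>x. (F x \<bullet> b) * \<phi> x \<partial>lebesgue_on K)"
    using K(1) f F \<phi> D
    by (intro Bochner_Integration.integral_add integrable_lebesgue_on_bounded_continuous
          continuous_intros)
       (auto simp: lmeasurable_compact fmeasurableD compact_imp_bounded)
  ultimately show "- (\<integral>x. f x * partial_derivative b \<phi> x \<partial>lebesgue_on \<Omega>) =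
      (\<integral>x. (F x \<bullet> b) * \<phi> x \<partial>lebesgue_on \<Omega>)"
    by (simp add: on_\<Omega> \<phi>_0 D_0 partial_derivative_def)
qed

section \<open>The equilibrium profile\<close>

text \<open>The only delicate point is the kink at \<open>0\<close>, where the difference quotient
  is at most \<open>\<bar>h\<bar> powr (q - 1)\<close> in absolute value and tends to
  \<open>0\<close> because \<open>q > 1\<close>.\<close>

lemma DERIV_max_0_powr:
  assumes "q > 1"
  shows "((\<lambda>s. max 0 s powr q) has_real_derivative q * max 0 s powr (q - 1)) (at s)"
proof -
  consider "s > 0" | "s = 0" | "s < 0" by linarith
  then show ?thesis
  proof cases
    case 1
    have "((\<lambda>s. max 0 s powr q) has_real_derivative q * s powr (q - 1)) (at s)"
      by (rule has_field_derivative_transform_within_open[OF has_real_derivative_powr[OF 1],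
            of "{0<..}"]) (use 1 in auto)
    then show ?thesis using 1 by simp
  next
    case 2
    have "((\<lambda>h. max 0 h powr q / h) \<longlongrightarrow> 0) (at (0::real))"
    proof (rule Lim_null_comparison)
      show "\<forall>\<^sub>F h in at (0::real). norm (max 0 h powr q / h) \<le> \<bar>h\<bar> powr (q - 1)"
        by (rule always_eventually) (auto simp: powr_diff max_def intro: divide_nonneg_neg)
      have "((\<lambda>h. \<bar>h\<bar> powr (q - 1)) \<longlongrightarrow> \<bar>0\<bar> powr (q - 1)) (at (0::real))"
        using assms by (intro tendsto_powr' tendsto_rabs tendsto_ident_at tendsto_const) auto
      then show "((\<lambda>h. \<bar>h\<bar> powr (q - 1)) \<longlongrightarrow> 0) (at (0::real))"
        by simp
    qed
    then show ?thesis using 2 by (simp add: DERIV_def)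
  next
    case 3
    have "((\<lambda>s. max 0 s powr q) has_real_derivative 0) (at s)"
      by (rule has_field_derivative_transform_within_open[OF DERIV_const[of 0], of "{..<0}"])
         (use 3 in auto)
    then show ?thesis using 3 by simp
  qed
qed

text \<open>Where \<open>\<rho> > 0\<close>, the equation \<open>\<nabla>p(\<rho>) = \<rho> g\<close> integrates to
  \<open>a * \<gamma> / (\<gamma> - 1) * \<rho> powr (\<gamma> - 1) = s\<close> with \<open>s = g \<bullet> x + c\<close>.\<close>

definition equilibrium_density :: "real \<Rightarrow> real \<Rightarrow> real \<Rightarrow> real" where
  "equilibrium_density a \<gamma> s = ((\<gamma> - 1) / (a * \<gamma>) * max 0 s) powr (1 / (\<gamma> - 1))"

lemma equilibrium_density_nonneg: "equilibrium_density a \<gamma> s \<ge> 0"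
  by (simp add: equilibrium_density_def)

lemma continuous_on_equilibrium_density:
  assumes "a > 0" "\<gamma> > 1"
  shows "continuous_on UNIV (equilibrium_density a \<gamma>)"
  unfolding equilibrium_density_def[abs_def]
  using assms by (intro continuous_on_powr' continuous_intros) auto

text \<open>The exponents satisfy \<open>\<gamma> / (\<gamma> - 1) = 1 + 1 / (\<gamma> - 1)\<close>,
  so one factor of the base splits off; this remains true in the vacuum, where both sides are
  \<open>0\<close>.\<close>

lemma pressure_equilibrium_density:
  assumes a: "a > 0" and \<gamma>: "\<gamma> > 1"
  shows "pressure a \<gamma> (equilibrium_density a \<gamma> s) =
     (\<gamma> - 1) / \<gamma> * (max 0 s * equilibrium_density a \<gamma> s)"
proof -
  let ?z = "(\<gamma> - 1) / (a * \<gamma>) * max 0 s"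
  have "?z \<ge> 0" using a \<gamma> by simp
  have "1 / (\<gamma> - 1) * \<gamma> = 1 + 1 / (\<gamma> - 1)"
    using \<gamma> by (simp add: field_simps)
  then have "equilibrium_density a \<gamma> s powr \<gamma> = ?z * equilibrium_density a \<gamma> s"
    using \<open>?z \<ge> 0\<close> by (simp only: equilibrium_density_def powr_powr powr_add powr_one)
  then show ?thesis
    using a by (simp add: pressure_def)
qed

text \<open>The pressure is a multiple of \<open>max 0 s powr (\<beta> + 1)\<close>, differentiable
  also at the vacuum boundary, and the constants cancel because
  \<open>\<beta> + 1 = \<gamma> / (\<gamma> - 1)\<close>.\<close>

lemma DERIV_pressure_equilibrium_density:
  assumes a: "a > 0" and \<gamma>: "\<gamma> > 1"
  shows "((\<lambda>s. pressure a \<gamma> (equilibrium_density a \<gamma> s)) has_real_derivative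
     equilibrium_density a \<gamma> s) (at s)"
proof -
  define \<beta> \<kappa> where "\<beta> = 1 / (\<gamma> - 1)" and "\<kappa> = (\<gamma> - 1) / (a * \<gamma>)"
  have "\<beta> > 0" "\<kappa> > 0"
    using a \<gamma> by (auto simp: \<beta>_def \<kappa>_def)
  have coeff: "(\<gamma> - 1) / \<gamma> * (\<beta> + 1) = 1"
    using \<gamma> by (simp add: \<beta>_def field_simps)
  have eq: "equilibrium_density a \<gamma> s = \<kappa> powr \<beta> * max 0 s powr \<beta>" for s
    using \<open>\<kappa> > 0\<close> powr_mult[of \<kappa> "max 0 s" \<beta>]
    by (simp only: equilibrium_density_def \<beta>_def \<kappa>_def)
  have "pressure a \<gamma> (equilibrium_density a \<gamma> s) =
      (\<gamma> - 1) / \<gamma> * \<kappa> powr \<beta> * max 0 s powr (\<beta> + 1)" for s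
    by (subst pressure_equilibrium_density[OF a \<gamma>]) (simp add: eq powr_add)
  moreover have "((\<lambda>s. (\<gamma> - 1) / \<gamma> * \<kappa> powr \<beta> * max 0 s powr (\<beta> + 1)) has_real_derivative
      (\<gamma> - 1) / \<gamma> * \<kappa> powr \<beta> * ((\<beta> + 1) * max 0 s powr \<beta>)) (at s)"
    using DERIV_max_0_powr[of "\<beta> + 1" s] \<open>\<beta> > 0\<close> by (intro DERIV_cmult) simp
  moreover have "(\<gamma> - 1) / \<gamma> * \<kappa> powr \<beta> * ((\<beta> + 1) * max 0 s powr \<beta>) =
      ((\<gamma> - 1) / \<gamma> * (\<beta> + 1)) * equilibrium_density a \<gamma> s"
    by (simp add: eq)
  ultimately show ?thesis
    by (simp only: coeff mult_1_left)
qed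

text \<open>For \<open>s \<ge> 0\<close> the pressure is
  \<open>(\<gamma> - 1) / \<gamma> * s\<close> times the density, and the density is unbounded in
  \<open>s\<close>.\<close>

lemma pressure_equilibrium_density_superlinear:
  assumes a: "a > 0" and \<gamma>: "\<gamma> > 1"
  shows "\<exists>s1. \<forall>s\<ge>s1. k * s \<le> pressure a \<gamma> (equilibrium_density a \<gamma> s)"
proof (intro exI allI impI)
  \<comment> \<open>\<open>K\<close> is the density at which the pressure reaches
    \<open>\<bar>k\<bar> * s\<close>; solving for the level gives the threshold
    \<open>K powr (\<gamma> - 1) / \<kappa>\<close>.\<close>
  define \<kappa> K where "\<kappa> = (\<gamma> - 1) / (a * \<gamma>)" and "K = \<bar>k\<bar> * (\<gamma> / (\<gamma> - 1))"
  have "\<kappa> > 0" "K \<ge> 0"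
    using a \<gamma> by (simp_all add: \<kappa>_def K_def)
  fix s assume s: "s \<ge> K powr (\<gamma> - 1) / \<kappa>"
  then have "s \<ge> 0"
    using \<open>\<kappa> > 0\<close> order_trans[OF divide_nonneg_pos[OF powr_ge_zero]] by blast
  have "K powr (\<gamma> - 1) \<le> \<kappa> * s"
    using s \<open>\<kappa> > 0\<close> by (simp add: pos_divide_le_eq mult.commute)
  then have "(K powr (\<gamma> - 1)) powr (1 / (\<gamma> - 1)) \<le> (\<kappa> * s) powr (1 / (\<gamma> - 1))"
    using \<gamma> by (intro powr_mono2) simp_all
  then have "K \<le> equilibrium_density a \<gamma> s"
    using \<gamma> \<open>K \<ge> 0\<close> \<open>s \<ge> 0\<close> by (simp add: powr_powr equilibrium_density_def \<kappa>_def max_def)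
  then have "K * (s * ((\<gamma> - 1) / \<gamma>)) \<le> equilibrium_density a \<gamma> s * (s * ((\<gamma> - 1) / \<gamma>))"
    using \<gamma> \<open>s \<ge> 0\<close> by (intro mult_right_mono) simp_all
  moreover have "K * (s * ((\<gamma> - 1) / \<gamma>)) = \<bar>k\<bar> * s"
    using \<gamma> by (simp add: K_def)
  moreover have "k * s \<le> \<bar>k\<bar> * s"
    using \<open>s \<ge> 0\<close> by (intro mult_right_mono) simp_all
  ultimately show "k * s \<le> pressure a \<gamma> (equilibrium_density a \<gamma> s)"
    using \<open>s \<ge> 0\<close> by (simp add: pressure_equilibrium_density[OF a \<gamma>] mult_ac)
qed

section \<open>Existence of an equilibrium\<close>

lemma integral_lebesgue_on_disjoint_Un:
  fixes f :: "'a::euclidean_space \<Rightarrow> 'b::euclidean_space"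
  assumes "A \<in> sets lebesgue" "B \<in> sets lebesgue" "A \<inter> B = {}"
    and "integrable (lebesgue_on A) f" "integrable (lebesgue_on B) f"
  shows "(\<integral>x. f x \<partial>lebesgue_on (A \<union> B)) = (\<integral>x. f x \<partial>lebesgue_on A) + (\<integral>x. f x \<partial>lebesgue_on B)"
proof -
  have [simp]: "S \<inter> space lebesgue \<in> sets lebesgue" if "S \<in> sets lebesgue" for S :: "'a set"
    using that by simp
  show ?thesis
    using set_integral_Un[of A B lebesgue f] assms sets.Un[OF assms(1,2)]
    unfolding set_lebesgue_integral_def set_integrable_def
    by (simp only: integral_restrict_space integrable_restrict_space space_completion
        space_lborel space_borel Int_UNIV_right simp_thms)
qed

text \<open>Gives the body a finite first moment, its density being merely integrable: on a bounded
  set the factor \<open>x\<close> is bounded.\<close>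

lemma integrable_scaleR_bounded_domain:
  fixes f :: "'a::euclidean_space \<Rightarrow> real"
  assumes "bounded A" "A \<in> sets lebesgue" "integrable (lebesgue_on A) f"
  shows "integrable (lebesgue_on A) (\<lambda>x. f x *\<^sub>R x)"
proof -
  obtain D where D: "\<And>x. x \<in> A \<Longrightarrow> norm x \<le> D"
    using assms(1) by (auto simp: bounded_iff)
  have "(\<lambda>x. x) \<in> borel_measurable (lebesgue_on A)"
    using assms(2) by (intro continuous_imp_measurable_on_sets_lebesgue continuous_on_id)
  show ?thesis
  proof (rule Bochner_Integration.integrable_bound)
    show "integrable (lebesgue_on A) (\<lambda>x. D * f x)"
      using assms(3) by simp
    show "(\<lambda>x. f x *\<^sub>R x) \<in> borel_measurable (lebesgue_on A)"
      using assms(3) \<open>(\<lambda>x. x) \<in> _\<close> by (intro borel_measurable_scaleR) auto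
    have "\<bar>f x\<bar> * norm x \<le> \<bar>D\<bar> * \<bar>f x\<bar>" if "x \<in> A" for x
      using mult_right_mono[OF order_trans[OF D[OF that] abs_ge_self], of "\<bar>f x\<bar>"]
      by (simp only: mult.commute[of "norm x"] abs_ge_zero simp_thms)
    then show "AE x in lebesgue_on A. norm (f x *\<^sub>R x) \<le> norm (D * f x)"
      by (intro AE_I2) (simp add: abs_mult)
  qed
qed

theorem theorem3p5:
  fixes C B :: "(real^3) set"
    and \<rho>B \<rho>0 :: "real^3 \<Rightarrow> real"
    and g0 :: "real^3"
    and a \<gamma> M g :: real
  assumes "open C" and "simply_connected C"
    and "frontier C \<subseteq> B" and "C \<inter> B = {}"
    and "bounded (B \<union> C)" and "simply_connected (B \<union> C)" and "open (B \<union> C)"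
    and "integrable (lebesgue_on B) \<rho>B"
    and "a > 0" and "\<gamma> > 3/2"
    and "\<rho>0 \<in> Lp_on \<gamma> C" and "AE x in lebesgue_on C. \<rho>0 x \<ge> 0"
    and "(\<integral>x. \<rho>0 x \<partial>lebesgue_on C) = M" and "M > 0"
    and "g0 $ 3 = 0" and "norm g0 = g" and "g > 0"
    and "convex C"
  shows "\<exists>(\<rho> :: real^3 \<Rightarrow> real) (gv :: real^3).
           \<rho> \<in> Lp_on \<gamma> C \<and> (AE x in lebesgue_on C. \<rho> x \<ge> 0) \<and> gv $ 3 = 0 \<and>
           (\<integral>x. \<rho> x \<partial>lebesgue_on C) = (\<integral>x. \<rho>0 x \<partial>lebesgue_on C) \<and>
           norm gv = norm g0 \<and>
           has_distributional_gradient_on (\<lambda>x. pressure a \<gamma> (\<rho> x)) (\<lambda>x. \<rho> x *\<^sub>R gv) C \<and>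
           axis 3 1 \<bullet>
             cross3 (\<integral>x. total_density C \<rho>B \<rho> x *\<^sub>R x \<partial>lebesgue_on (B \<union> C)) gv = 0"
proof -
  have \<gamma>: "\<gamma> > 1"
    using \<open>\<gamma> > 3/2\<close> by simp
  let ?\<rho> = "equilibrium_density a \<gamma>"
  \<comment> \<open>The cavity is nonempty because it carries the positive mass
    \<open>M\<close>.\<close>
  have C: "bounded C" "C \<in> sets lebesgue" "C \<noteq> {}"
    using assms(1,5,13,14) by auto
  \<comment> \<open>The body is measurable as a difference of two open sets.\<close>
  have "B = (B \<union> C) - C"
    using \<open>C \<inter> B = {}\<close> by blast
  then have B: "B \<in> sets lebesgue" "bounded B"
    using assms(1,5,7) by (metis borel_open sets.Diff sets_completionI_sets sets_lborel, simp)
  define S where "S = {v::real^3. v $ 3 = 0 \<and> norm v = g}"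
  \<comment> \<open>The vector product of \<open>e\<^sub>3\<close> with \<open>v\<close>, a quarter
    turn in the horizontal plane. The inner product of \<open>w\<close> with \<open>J v\<close> is
    minus the axial component of \<open>cross3 w v\<close>.\<close>
  define J where "J v = (vector [- v $ 2, v $ 1, 0] :: real^3)" for v :: "real^3"
  have "compact S"
  proof -
    have "closed {v::real^3. v $ 3 = 0}"
      by (intro closed_Collect_eq continuous_intros)
    then have "compact ({v::real^3. v $ 3 = 0} \<inter> sphere 0 g)"
      by (simp add: closed_Int_compact)
    moreover have "S = {v::real^3. v $ 3 = 0} \<inter> sphere 0 g"
      by (auto simp: S_def)
    ultimately show ?thesis by simp
  qed
  have "cos t *\<^sub>R v + sin t *\<^sub>R J v \<in> S" if "v \<in> S" for v t
  proof -
    have v: "v $ 3 = 0" "norm v = g"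
      using that by (auto simp: S_def)
    have "(cos t * v $ 1 - sin t * v $ 2)\<^sup>2 + (cos t * v $ 2 + sin t * v $ 1)\<^sup>2 =
        ((sin t)\<^sup>2 + (cos t)\<^sup>2) * ((v $ 1)\<^sup>2 + (v $ 2)\<^sup>2)"
      by algebra
    then have "(cos t * v $ 1 - sin t * v $ 2)\<^sup>2 + (cos t * v $ 2 + sin t * v $ 1)\<^sup>2 =
        (v $ 1)\<^sup>2 + (v $ 2)\<^sup>2"
      by simp
    then have "norm (cos t *\<^sub>R v + sin t *\<^sub>R J v) = norm v"
      using v(1) by (simp add: norm_eq_sqrt_inner inner_vec_def sum_3 J_def power2_eq_square)
    then show ?thesis
      using v by (simp add: S_def J_def)
  qed
  moreover have "S \<noteq> {}"
    using assms(15,16) by (auto simp: S_def)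
  \<comment> \<open>The potential is taken with the body's first moment as \<open>m\<close>, so its
    critical point balances the torque of body and fluid together.\<close>
  ultimately obtain v c where v: "v \<in> S"
    and mass: "(\<integral>x. ?\<rho> (v \<bullet> x + c) \<partial>lebesgue_on C) = M"
    and torque: "((\<integral>x. \<rho>B x *\<^sub>R x \<partial>lebesgue_on B) +
        (\<integral>x. ?\<rho> (v \<bullet> x + c) *\<^sub>R x \<partial>lebesgue_on C)) \<bullet> J v = 0"
    using exists_critical_direction_and_level[OF \<open>open C\<close> C(1,3)
        DERIV_pressure_equilibrium_density[OF \<open>a > 0\<close> \<gamma>] _
        continuous_on_equilibrium_density[OF \<open>a > 0\<close> \<gamma>]
        pressure_equilibrium_density_superlinear[OF \<open>a > 0\<close> \<gamma>] \<open>compact S\<close> _ _ \<open>M > 0\<close>,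
        of J "\<integral>x. \<rho>B x *\<^sub>R x \<partial>lebesgue_on B"] \<open>a > 0\<close>
    by (auto simp: pressure_def)
  define \<rho> where "\<rho> x = ?\<rho> (v \<bullet> x + c)" for x
  have \<rho>_nonneg: "\<rho> x \<ge> 0" for x
    by (simp add: \<rho>_def equilibrium_density_nonneg)
  have \<rho>: "continuous_on UNIV \<rho>"
    unfolding \<rho>_def
    by (intro continuous_on_compose2[OF continuous_on_equilibrium_density[OF \<open>a > 0\<close> \<gamma>]]
        continuous_intros) auto
  have "continuous_on UNIV (\<lambda>x. \<bar>\<rho> x\<bar> powr \<gamma>)"
    using \<rho> \<gamma> by (intro continuous_on_powr' continuous_intros) auto
  then have "\<rho> \<in> Lp_on \<gamma> C"
    unfolding Lp_on_def
    using integrable_lebesgue_on_bounded_continuous[OF C(1,2)] \<rho>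
    by (auto intro: borel_measurable_integrable)
  moreover have "has_distributional_gradient_on (\<lambda>x. pressure a \<gamma> (\<rho> x)) (\<lambda>x. \<rho> x *\<^sub>R v) C"
  proof (rule C1_imp_distributional_gradient[OF _ _ C(2)])
    show "((\<lambda>x. pressure a \<gamma> (\<rho> x)) has_derivative (\<lambda>y. \<rho> x *\<^sub>R v \<bullet> y)) (at x)" for x
    proof -
      \<comment> \<open>The level has gradient \<open>v\<close> and the pressure has derivative
        \<open>?\<rho>\<close> in the level, on the vacuum region too, so the classical identity
        holds everywhere.\<close>
      have "((\<lambda>x. v \<bullet> x + c) has_derivative (\<lambda>y. v \<bullet> y)) (at x)"
        by (auto intro!: derivative_eq_intros)
      from has_derivative_compose[OF this DERIV_pressure_equilibrium_density[OF \<open>a > 0\<close> \<gamma>,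
            unfolded has_field_derivative_def]]
      show ?thesis
        by (simp add: \<rho>_def)
    qed
    show "continuous_on UNIV (\<lambda>x. \<rho> x *\<^sub>R v)"
      using \<rho> by (intro continuous_intros)
  qed
  moreover have "axis 3 1 \<bullet>
      cross3 (\<integral>x. total_density C \<rho>B \<rho> x *\<^sub>R x \<partial>lebesgue_on (B \<union> C)) v = 0"
  proof -
    let ?F = "\<lambda>x. total_density C \<rho>B \<rho> x *\<^sub>R x"
    have F_B: "?F x = \<rho>B x *\<^sub>R x" if "x \<in> space (lebesgue_on B)" for x
      using that \<open>C \<inter> B = {}\<close> by (auto simp: total_density_def)
    have F_C: "?F x = \<rho> x *\<^sub>R x" if "x \<in> space (lebesgue_on C)" for x
      using that by (simp add: total_density_def)
    have "integrable (lebesgue_on B) ?F"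
      using integrable_scaleR_bounded_domain[OF B(2,1) assms(8)]
      by (rule Bochner_Integration.integrable_cong[THEN iffD2, rotated -1]) (auto simp: F_B)
    moreover have "integrable (lebesgue_on C) ?F"
      using \<rho>
      by (subst Bochner_Integration.integrable_cong[OF refl F_C])
         (auto intro!: integrable_lebesgue_on_bounded_continuous[OF C(1,2)] continuous_intros)
    ultimately have "(\<integral>x. ?F x \<partial>lebesgue_on (B \<union> C)) =
        (\<integral>x. ?F x \<partial>lebesgue_on B) + (\<integral>x. ?F x \<partial>lebesgue_on C)"
      using integral_lebesgue_on_disjoint_Un[OF B(1) C(2)] assms(4) by (simp add: Int_commute)
    also have "\<dots> = (\<integral>x. \<rho>B x *\<^sub>R x \<partial>lebesgue_on B) + (\<integral>x. \<rho> x *\<^sub>R x \<partial>lebesgue_on C)"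
      by (simp only: Bochner_Integration.integral_cong[OF refl F_B]
          Bochner_Integration.integral_cong[OF refl F_C])
    finally have "(\<integral>x. ?F x \<partial>lebesgue_on (B \<union> C)) \<bullet> J v = 0"
      using torque by (simp add: \<rho>_def)
    \<comment> \<open>In coordinates the axial torque is the negative of the vanishing inner product
      with \<open>J v\<close>.\<close>
    then show ?thesis
      by (simp add: J_def inner_vec_def sum_3 cross3_def axis_def algebra_simps)
  qed
  moreover have "v $ 3 = 0" "norm v = norm g0"
    using v \<open>norm g0 = g\<close> by (auto simp: S_def)
  moreover have "(\<integral>x. \<rho> x \<partial>lebesgue_on C) = (\<integral>x. \<rho>0 x \<partial>lebesgue_on C)"
    using mass assms(13) by (simp add: \<rho>_def)
  ultimately show ?thesis
    using \<rho>_nonneg by (intro exI[of _ \<rho>] exI[of _ v]) auto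
qed

end
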